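(* Let $\mathfrak S\subset S^1$ be a set such that no non-trivial homogeneous polynomial (in two variables) vanishes on $\mathfrak S$. Let $f\in C(\mathbb{R}^3)$ have compact support in $\{\mathbf{x}=(x_1,x_2,x_3)\in\mathbb{R}^3 : x_2>0\}$. If $Cf(u,\beta,s)=0$ for all $\beta\in[0,2\pi)$ with $(\cos\beta,\sin\beta)\in\mathfrak S$ and all $(u,s)\in\mathbb{R}\times[-1,1]$, then $f=0$.
   Context: The conical Radon transform of a compactly supported function $f$ on $\mathbb{R}^3$ is defined, for $u\in\mathbb{R}$, $\beta\in[0,2\pi)$, $s\in[-1,1]$, by $$Cf(u,\beta,s)=\int_{S^2}\int_0^\infty f((u,0,0)+r\boldsymbol\alpha)\,r\,\delta(\boldsymbol\alpha\cdot\boldsymbol\beta-s)\,{\rm d}r\,{\rm d}S(\boldsymbol\alpha),\qquad \boldsymbol\beta=(\cos\beta,0,\sin\beta)\in S^2,$$ where $\delta$ is the Dirac delta and ${\rm d}S$ is the standard surface measure on the unit sphere $S^2\subset\mathbb{R}^3$. Explicitly, for continuous $\phi$ on $S^2$ and $s\in[-1,1]$, $$\int_{S^2}\phi(\boldsymbol\alpha)\,\delta(\boldsymbol\alpha\cdot\boldsymbol\beta-s)\,{\rm d}S(\boldsymbol\alpha)=\int_0^{2\pi}\phi\big(s\boldsymbol\beta+\sqrt{1-s^2}\,(\cos\theta\,\mathbf{e}_1+\sin\theta\,\mathbf{e}_2)\big)\,{\rm d}\theta,$$ where $\mathbf{e}_1,\mathbf{e}_2$ is any orthonormal basis of $\boldsymbol\beta^\perp$;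 $Cf$ is obtained with $\phi(\boldsymbol\alpha)=\int_0^\infty f((u,0,0)+r\boldsymbol\alpha)\,r\,{\rm d}r$. "Compact support in $V$" means that the support of $f$ is a compact subset of $V$. *)

theory Defs
  imports "HOL-Analysis.Analysis" "HOL-Computational_Algebra.Polynomial"
begin

(* A bivariate real polynomial is an element of (R[X])[Y], i.e. of type real poly poly:
   coeff (coeff p j) i is the coefficient of X^i Y^j. *)

definition eval_poly2 :: "real poly poly \<Rightarrow> real ^ 2 \<Rightarrow> real" where
  "eval_poly2 p v = poly (poly p [:v $ 2:]) (v $ 1)"

definition homogeneous_poly2 :: "nat \<Rightarrow> real poly poly \<Rightarrow> bool" where
  "homogeneous_poly2 d p \<longleftrightarrow> (\<forall>i j. coeff (coeff p j) i \<noteq> 0 \<longrightarrow> i + j = d)"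

lemma eval_poly2_eq_sum:
  "eval_poly2 p v = (\<Sum>j\<le>degree p. \<Sum>i\<le>degree (coeff p j). coeff (coeff p j) i * v $ 1 ^ i * v $ 2 ^ j)"
proof -
  have "poly (poly p [:y:]) x = (\<Sum>j\<le>degree p. poly (coeff p j) x * y ^ j)" for x y :: real
    by (simp add: poly_altdef[of p] poly_sum poly_mult)
  then show ?thesis
    by (simp add: eval_poly2_def poly_altdef sum_distrib_right)
qed

definition compact_support_in :: "('a :: topological_space \<Rightarrow> 'b :: zero) \<Rightarrow> 'a set \<Rightarrow> bool" where
  "compact_support_in f V \<longleftrightarrow> compact (closure {x. f x \<noteq> 0}) \<and> closure {x. f x \<noteq> 0} \<subseteq> V"

(* The integral of phi over the unit sphere against delta(alpha . b - s), written in terms of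
   an orthonormal basis e1, e2 of the orthogonal complement of the unit vector b.  The choice of
   that basis is immaterial, see sphere_delta_integral_basis_independent. *)
definition sphere_delta_integral ::
  "(real ^ 3 \<Rightarrow> real) \<Rightarrow> real ^ 3 \<Rightarrow> real ^ 3 \<Rightarrow> real ^ 3 \<Rightarrow> real \<Rightarrow> real" where
  "sphere_delta_integral \<phi> b e1 e2 s =
     integral {0..2 * pi} (\<lambda>\<theta>. \<phi> (s *\<^sub>R b + sqrt (1 - s\<^sup>2) *\<^sub>R (cos \<theta> *\<^sub>R e1 + sin \<theta> *\<^sub>R e2)))"

definition cone_axis :: "real \<Rightarrow> real ^ 3" where
  "cone_axis \<beta> = vector [cos \<beta>, 0, sin \<beta>]"

definition conical_radon :: "(real ^ 3 \<Rightarrow> real) \<Rightarrow> real \<Rightarrow> real \<Rightarrow> real \<Rightarrow> real" where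
  "conical_radon f u \<beta> s =
     sphere_delta_integral
       (\<lambda>\<alpha>. integral {0..} (\<lambda>r. f (vector [u, 0, 0] + r *\<^sub>R \<alpha>) * r))
       (cone_axis \<beta>) (vector [- sin \<beta>, 0, cos \<beta>]) (vector [0, 1, 0]) s"

definition orthonormal3 :: "real ^ 3 \<Rightarrow> real ^ 3 \<Rightarrow> real ^ 3 \<Rightarrow> bool" where
  "orthonormal3 b e1 e2 \<longleftrightarrow>
     norm b = 1 \<and> norm e1 = 1 \<and> norm e2 = 1 \<and> b \<bullet> e1 = 0 \<and> b \<bullet> e2 = 0 \<and> e1 \<bullet> e2 = 0"

lemma orthonormal3_cone_axis:
  "orthonormal3 (cone_axis \<beta>) (vector [- sin \<beta>, 0, cos \<beta>]) (vector [0, 1, 0])"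
  by (simp add: orthonormal3_def cone_axis_def norm_eq_sqrt_inner inner_vec_def sum_3
      flip: power2_eq_square)

lemma orthonormal3_expand:
  assumes "orthonormal3 b e1 e2"
  shows "x = (x \<bullet> b) *\<^sub>R b + (x \<bullet> e1) *\<^sub>R e1 + (x \<bullet> e2) *\<^sub>R e2"
proof -
  define z where "z = x - ((x \<bullet> b) *\<^sub>R b + (x \<bullet> e1) *\<^sub>R e1 + (x \<bullet> e2) *\<^sub>R e2)"
  note on = assms[unfolded orthonormal3_def norm_eq_1]
  have z: "z \<bullet> b = 0" "z \<bullet> e1 = 0" "z \<bullet> e2 = 0"
    using on by (simp_all add: z_def inner_commute inner_diff_right inner_add_right)
  have "z = 0"
  proof (rule ccontr)
    assume "z \<noteq> 0"
    have ne: "b \<noteq> 0" "e1 \<noteq> 0" "e2 \<noteq> 0"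
      using on by auto
    have dist: "distinct [z, b, e1, e2]"
      using on z \<open>z \<noteq> 0\<close> ne by auto
    have "pairwise orthogonal {z, b, e1, e2}"
      using on z by (auto simp: pairwise_def orthogonal_def inner_commute)
    then have "independent {z, b, e1, e2}"
      using \<open>z \<noteq> 0\<close> ne by (intro pairwise_orthogonal_independent) auto
    then have "card {z, b, e1, e2} \<le> DIM(real ^ 3)"
      using independent_bound by blast
    then show False
      using dist by simp
  qed
  then show ?thesis
    by (simp add: z_def)
qed

lemma integral_periodic_shift:
  fixes g :: "real \<Rightarrow> real"
  assumes cont: "continuous_on UNIV g" and per: "\<And>x. g (x + T) = g x" and a: "0 \<le> a" "a \<le> T"
  shows "integral {0..T} (\<lambda>x. g (x + a)) = integral {0..T} g"
proof -
  have int: "g integrable_on {c..d}" for c d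
    using cont continuous_on_subset integrable_continuous_real by blast
  have "integral {0..T} (\<lambda>x. g (x + a)) = integral {a..T + a} g"
    using integral_shift_Icc_real[of 0 T g a] by (simp add: o_def add.commute)
  also have "\<dots> = integral {a..T} g + integral {T..T + a} g"
    using a int by (intro Henstock_Kurzweil_Integration.integral_combine[symmetric]) auto
  also have "integral {T..T + a} g = integral {0..a} g"
    using integral_shift_Icc_real[of 0 a g T] per by (simp add: o_def add.commute)
  also have "integral {a..T} g + integral {0..a} g = integral {0..T} g"
    using a int Henstock_Kurzweil_Integration.integral_combine[of 0 a T g] by simp
  finally show ?thesis .
qed

lemma sphere_delta_integral_basis_independent:
  assumes cont: "continuous_on (sphere 0 1) \<phi>" and s: "s \<in> {-1..1}"
    and on: "orthonormal3 b e1 e2" and on': "orthonormal3 b e1' e2'"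
  shows "sphere_delta_integral \<phi> b e1' e2' s = sphere_delta_integral \<phi> b e1 e2 s"
proof -
  note o = on[unfolded orthonormal3_def norm_eq_1] and o' = on'[unfolded orthonormal3_def norm_eq_1]
  have e1': "e1' = (e1' \<bullet> e1) *\<^sub>R e1 + (e1' \<bullet> e2) *\<^sub>R e2"
    using orthonormal3_expand[OF on, of e1'] o' by (simp add: inner_commute)
  have e2': "e2' = (e2' \<bullet> e1) *\<^sub>R e1 + (e2' \<bullet> e2) *\<^sub>R e2"
    using orthonormal3_expand[OF on, of e2'] o' by (simp add: inner_commute)
  define p q r t where pqrt: "p = e1' \<bullet> e1" "q = e1' \<bullet> e2" "r = e2' \<bullet> e1" "t = e2' \<bullet> e2"
  have "p\<^sup>2 + q\<^sup>2 = e1' \<bullet> e1'"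
    using arg_cong[OF e1', of "inner e1'"]
    by (simp add: inner_add_right pqrt power2_eq_square)
  then have pq1: "p\<^sup>2 + q\<^sup>2 = 1" using o' by simp
  have "r\<^sup>2 + t\<^sup>2 = e2' \<bullet> e2'"
    using arg_cong[OF e2', of "inner e2'"]
    by (simp add: inner_add_right pqrt power2_eq_square)
  then have rt1: "r\<^sup>2 + t\<^sup>2 = 1" using o' by simp
  have "p * r + q * t = e1' \<bullet> e2'"
    using arg_cong[OF e2', of "inner e1'"]
    by (simp add: inner_add_right pqrt mult.commute)
  then have prqt: "p * r + q * t = 0" using o' by simp
  obtain a where a: "0 \<le> a" "a < 2 * pi" "p = cos a" "q = sin a"
    using sincos_total_2pi[OF pq1] by metis
  define k where "k = p * t - q * r"
  have "k\<^sup>2 + (p * r + q * t)\<^sup>2 = (p\<^sup>2 + q\<^sup>2) * (r\<^sup>2 + t\<^sup>2)"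
    by (simp add: k_def power2_eq_square algebra_simps)
  then have k2: "k = 1 \<or> k = -1"
    using pq1 rt1 prqt by (simp add: power2_eq_1_iff)
  have "r = (p\<^sup>2 + q\<^sup>2) * r" using pq1 by simp
  also have "\<dots> = p * (p * r + q * t) - q * k"
    by (simp add: k_def power2_eq_square algebra_simps)
  finally have r: "r = - k * sin a" using prqt a by simp
  have "t = (p\<^sup>2 + q\<^sup>2) * t" using pq1 by simp
  also have "\<dots> = q * (p * r + q * t) + p * k"
    by (simp add: k_def power2_eq_square algebra_simps)
  finally have t: "t = k * cos a" using prqt a by simp
  define g where "g \<theta> = \<phi> (s *\<^sub>R b + sqrt (1 - s\<^sup>2) *\<^sub>R (cos \<theta> *\<^sub>R e1 + sin \<theta> *\<^sub>R e2))" for \<theta>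
  have s2: "s\<^sup>2 \<le> 1"
    using s by (simp add: abs_square_le_1 abs_le_iff)
  have unit: "s *\<^sub>R b + sqrt (1 - s\<^sup>2) *\<^sub>R (cos \<theta> *\<^sub>R e1 + sin \<theta> *\<^sub>R e2) \<in> sphere 0 1" for \<theta>
  proof -
    have "(sqrt (1 - s\<^sup>2))\<^sup>2 = 1 - s\<^sup>2"
      using s2 by simp
    moreover have "(cos \<theta> *\<^sub>R e1 + sin \<theta> *\<^sub>R e2) \<bullet> (cos \<theta> *\<^sub>R e1 + sin \<theta> *\<^sub>R e2) = 1"
      using o by (simp add: inner_add_left inner_add_right inner_commute flip: power2_eq_square)
    moreover have "b \<bullet> (cos \<theta> *\<^sub>R e1 + sin \<theta> *\<^sub>R e2) = 0"
      using o by (simp add: inner_add_right)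
    ultimately show ?thesis
      using o by (simp add: norm_eq_1 inner_commute inner_add_left[of "s *\<^sub>R b"]
          inner_add_right[of _ "s *\<^sub>R b"] flip: power2_eq_square mult.assoc)
  qed
  have contg: "continuous_on UNIV g"
    unfolding g_def using unit
    by (intro continuous_on_compose2[OF cont] continuous_intros) auto
  have per: "g (x + 2 * pi) = g x" for x
    by (simp add: g_def)
  have rot: "cos \<theta> *\<^sub>R e1' + sin \<theta> *\<^sub>R e2' = cos (a + k * \<theta>) *\<^sub>R e1 + sin (a + k * \<theta>) *\<^sub>R e2" for \<theta>
  proof -
    have "cos \<theta> *\<^sub>R e1' + sin \<theta> *\<^sub>R e2' =
        (cos \<theta> * p + sin \<theta> * r) *\<^sub>R e1 + (cos \<theta> * q + sin \<theta> * t) *\<^sub>R e2"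
      by (subst e1', subst e2') (simp add: pqrt algebra_simps)
    also have "\<dots> = cos (a + k * \<theta>) *\<^sub>R e1 + sin (a + k * \<theta>) *\<^sub>R e2"
      using k2 by (auto simp: a r t cos_add sin_add cos_diff sin_diff algebra_simps)
    finally show ?thesis .
  qed
  have "sphere_delta_integral \<phi> b e1' e2' s = integral {0..2 * pi} (\<lambda>\<theta>. g (a + k * \<theta>))"
    by (simp add: sphere_delta_integral_def rot g_def)
  also have "\<dots> = integral {0..2 * pi} g"
    using k2
  proof
    assume "k = 1"
    then show ?thesis
      using integral_periodic_shift[OF contg per, of a] a by (simp add: add.commute)
  next
    assume k: "k = -1"
    define h where "h x = g (- x)" for x
    have conth: "continuous_on UNIV h"
      unfolding h_def by (intro continuous_on_compose2[OF contg] continuous_intros) auto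
    have perh: "h (x + 2 * pi) = h x" for x
      using per[of "- x - 2 * pi"] by (simp add: h_def)
    have shift_h: "h (x + (2 * pi - a)) = g (a + k * x)" for x
      using per[of "a - x - 2 * pi"] by (simp add: h_def k algebra_simps)
    have "integral {0..2 * pi} (\<lambda>\<theta>. g (a + k * \<theta>)) = integral {0..2 * pi} h"
      using integral_periodic_shift[OF conth perh, of "2 * pi - a"] a by (simp add: shift_h)
    also have "\<dots> = integral {0..2 * pi} (\<lambda>x. h (x - 2 * pi))"
      using perh[of "_ - 2 * pi"] by simp
    also have "\<dots> = integral {- (2 * pi)..0} h"
      using integral_shift_Icc_real[of "0" "2 * pi" h "- (2 * pi)"] by (simp add: o_def)
    also have "\<dots> = integral {0..2 * pi} g"
      using Henstock_Kurzweil_Integration.integral_reflect_real[of "2 * pi" 0 g]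
      by (simp add: h_def[abs_def])
    finally show ?thesis .
  qed
  finally show ?thesis
    by (simp add: sphere_delta_integral_def g_def[abs_def])
qed

end

theory Submission
  imports Defs
begin

text \<open>
  Writing the area element of the upper hemisphere in the coordinates $(\alpha_1, \alpha_3)$ of the
  unit disc, the cone integrals with vertex $(u,0,0)$ and axis $\beta$ become line integrals, over the
  lines perpendicular to $(\cos\beta, \sin\beta)$, of the ray integrals
  $\int_0^\infty f((u,0,0) + r\alpha)\, r\, dr$ divided by $\alpha_2$. The assumption on $S$ makes
  the set of slopes $\tan\beta$ infinite. A compactly supported function in the plane whose line
  integrals vanish for infinitely many directions is zero: for each $k$, its moments of total degree
  $k$ are, up to binomial factors, the coefficients of a polynomial in the slope, and vanishing of all
  moments suffices by
  Stone--Weierstrass. So all ray integrals vanish. On a half plane $x_3 = m x_2$, $x_2 > 0$, they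
  are, up to a nonzero factor, the line integrals of $x_2 f$, and the same argument gives $f = 0$.
\<close>

section \<open>Homogeneous polynomials in two variables and the slopes of \<open>S\<close>\<close>

lemma homogeneous_poly2_mult:
  assumes "homogeneous_poly2 d p" "homogeneous_poly2 e q"
  shows "homogeneous_poly2 (d + e) (p * q)"
  unfolding homogeneous_poly2_def
proof (intro allI impI)
  fix i j
  assume "coeff (coeff (p * q) j) i \<noteq> 0"
  then have "(\<Sum>k\<le>j. coeff (coeff p k * coeff q (j - k)) i) \<noteq> 0"
    by (simp add: coeff_mult[of p] coeff_sum)
  then obtain k where k: "k \<le> j" "coeff (coeff p k * coeff q (j - k)) i \<noteq> 0"
    by (meson atMost_iff sum.not_neutral_contains_not_neutral)
  then have "(\<Sum>l\<le>i. coeff (coeff p k) l * coeff (coeff q (j - k)) (i - l)) \<noteq> 0"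
    by (simp add: coeff_mult)
  then obtain l where l: "l \<le> i" "coeff (coeff p k) l * coeff (coeff q (j - k)) (i - l) \<noteq> 0"
    by (meson atMost_iff sum.not_neutral_contains_not_neutral)
  then have "l + k = d" "(i - l) + (j - k) = e"
    using assms by (auto simp: homogeneous_poly2_def)
  then show "i + j = d + e"
    using k l by linarith
qed

lemma homogeneous_poly2_prod:
  assumes "finite T" "\<And>t. t \<in> T \<Longrightarrow> homogeneous_poly2 1 (p t)"
  shows "homogeneous_poly2 (card T) (\<Prod>t\<in>T. p t)"
  using assms
proof (induction T rule: finite_induct)
  case empty
  then show ?case
    by (auto simp: homogeneous_poly2_def coeff_1)
next
  case (insert t T)
  then have "homogeneous_poly2 (1 + card T) (p t * (\<Prod>t\<in>T. p t))"
    by (intro homogeneous_poly2_mult) auto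
  then show ?case
    using insert by simp
qed

text \<open>With only finitely many slopes \<open>t\<close>, the product of the linear forms
  \<open>Y - t * X\<close>, times a further factor \<open>X\<close> for the points with
  \<open>v $ 1 = 0\<close>, would be a nonzero homogeneous polynomial vanishing on
  \<open>S\<close>.\<close>

lemma infinite_slopes:
  assumes S: "\<not> (\<exists>d p. homogeneous_poly2 d p \<and> p \<noteq> 0 \<and> (\<forall>v\<in>S. eval_poly2 p v = 0))"
  shows "infinite ((\<lambda>v. v $ 2 / v $ 1) ` {v \<in> S. v $ 1 \<noteq> 0})" (is "infinite ?T")
proof
  assume fin: "finite ?T"
  define X where "X = [:[:0, 1 :: real:]:]"
  \<comment> \<open>Read by powers of \<open>Y\<close>, this is the linear form
    \<open>Y - t * X\<close>.\<close>
  define L where "L t = [:[:0, - t:], [:1 :: real:]:]" for t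
  define p where "p = X * (\<Prod>t\<in>?T. L t)"
  have "homogeneous_poly2 1 X"
    by (auto simp: homogeneous_poly2_def X_def coeff_pCons split: nat.splits)
  moreover have "homogeneous_poly2 1 (L t)" for t
    by (auto simp: homogeneous_poly2_def L_def coeff_pCons split: nat.splits)
  ultimately have "homogeneous_poly2 (1 + card ?T) p"
    unfolding p_def by (intro homogeneous_poly2_mult homogeneous_poly2_prod fin) auto
  moreover have "p \<noteq> 0"
    using fin by (simp add: p_def X_def L_def)
  moreover have "eval_poly2 p v = 0" if "v \<in> S" for v
  proof (cases "v $ 1 = 0")
    case True
    then show ?thesis
      by (simp add: eval_poly2_def p_def X_def)
  next
    case False
    then have mem: "v $ 2 / v $ 1 \<in> ?T"
      using that by auto
    have "eval_poly2 p v = v $ 1 * (\<Prod>t\<in>?T. v $ 2 - t * v $ 1)"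
      by (simp add: eval_poly2_def p_def X_def L_def poly_prod mult.commute)
    also have "(\<Prod>t\<in>?T. v $ 2 - t * v $ 1) = 0"
      using False by (intro prod_zero[OF fin] bexI[OF _ mem]) simp
    finally show ?thesis
      by simp
  qed
  ultimately show False
    using S by blast
qed

section \<open>Moments and line integrals of compactly supported functions in the plane\<close>

lemma integrable_lborel_bounded_support:
  fixes g :: "'a :: euclidean_space \<Rightarrow> real"
  assumes "continuous_on UNIV g" "bounded {x. g x \<noteq> 0}"
  shows "integrable lborel g"
proof -
  let ?K = "closure {x. g x \<noteq> 0}"
  have "compact ?K"
    using assms(2) by simp
  then have "integrable lborel (\<lambda>x. indicator ?K x *\<^sub>R g x)"
    using assms(1) by (intro borel_integrable_compact) (auto intro: continuous_on_subset)
  also have "(\<lambda>x. indicator ?K x *\<^sub>R g x) = g"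
    using closure_subset[of "{x. g x \<noteq> 0}"] by (fastforce simp: indicator_def)
  finally show ?thesis .
qed

lemma bounded_support_mult:
  fixes g h :: "'a :: metric_space \<Rightarrow> real"
  assumes "bounded {x. g x \<noteq> 0}"
  shows "bounded {x. h x * g x \<noteq> 0}"
  by (rule bounded_subset[OF assms]) auto

lemma continuous_on_real_polynomial_function:
  "real_polynomial_function p \<Longrightarrow> continuous_on A p"
  using continuous_on_polymonial_function continuous_at_imp_continuous_on
    continuous_real_polymonial_function by blast

text \<open>A linear factor only raises the exponents of the moments by one. The induction keeps
  \<open>g\<close> general for the sake of products \<open>p * q\<close>: the hypothesis on
  \<open>q\<close> kills the moments of \<open>q * g\<close>, and the one on \<open>p\<close> is
  then applied to \<open>q * g\<close> instead of \<open>g\<close>.\<close>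

lemma moments_zero_mult_polynomial:
  fixes g p :: "real \<times> real \<Rightarrow> real"
  assumes "real_polynomial_function p" "continuous_on UNIV g" "bounded {z. g z \<noteq> 0}"
    and "\<And>i j. (LINT z|lborel. fst z ^ i * snd z ^ j * g z) = 0"
  shows "(LINT z|lborel. fst z ^ i * snd z ^ j * (p z * g z)) = 0"
  using assms
proof (induction p arbitrary: g i j)
  case lin: (linear l)
  interpret bounded_linear l by (fact lin(1))
  have int: "integrable lborel (\<lambda>z. fst z ^ i * snd z ^ j * g z)" for i j
    by (intro integrable_lborel_bounded_support bounded_support_mult lin(2,3) continuous_intros)
  have expand: "l z = l (1, 0) * fst z + l (0, 1) * snd z" for z
  proof -
    have "z = fst z *\<^sub>R (1, 0) + snd z *\<^sub>R (0, 1)"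
      by (simp add: prod_eq_iff)
    then have "l z = l (fst z *\<^sub>R (1, 0) + snd z *\<^sub>R (0, 1))"
      by (rule arg_cong)
    also have "\<dots> = l (1, 0) * fst z + l (0, 1) * snd z"
      by (simp only: add scaleR real_scaleR_def mult.commute)
    finally show ?thesis .
  qed
  have "(LINT z|lborel. fst z ^ i * snd z ^ j * (l z * g z)) =
      (LINT z|lborel. l (1, 0) * (fst z ^ Suc i * snd z ^ j * g z) +
                      l (0, 1) * (fst z ^ i * snd z ^ Suc j * g z))"
    by (subst expand) (simp add: algebra_simps)
  also have "\<dots> = l (1, 0) * (LINT z|lborel. fst z ^ Suc i * snd z ^ j * g z) +
                  l (0, 1) * (LINT z|lborel. fst z ^ i * snd z ^ Suc j * g z)"
    using int[of "Suc i" j] int[of i "Suc j"]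
    by (subst Bochner_Integration.integral_add) (auto simp del: power_Suc)
  finally show ?case
    using lin(4) by (simp del: power_Suc)
next
  case (const c)
  have "(LINT z|lborel. fst z ^ i * snd z ^ j * (c * g z)) =
      (LINT z|lborel. c * (fst z ^ i * snd z ^ j * g z))"
    by (simp add: mult_ac)
  then show ?case
    using const by simp
next
  case (add p q)
  have "integrable lborel (\<lambda>z. fst z ^ i * snd z ^ j * (p z * g z))"
    "integrable lborel (\<lambda>z. fst z ^ i * snd z ^ j * (q z * g z))"
    by (intro integrable_lborel_bounded_support bounded_support_mult add continuous_intros
        continuous_on_real_polynomial_function)+
  then show ?case
    using add by (simp add: distrib_left distrib_right)
next
  case (mult p q)
  have "(LINT z|lborel. fst z ^ i * snd z ^ j * (p z * (q z * g z))) = 0"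
    by (intro mult.IH(1) bounded_support_mult mult continuous_intros
        continuous_on_real_polynomial_function)
  then show ?case
    by (simp add: mult_ac)
qed

text \<open>If a polynomial \<open>p\<close> is uniformly within \<open>e\<close> of
  \<open>g\<close> on the support, then \<open>p * g\<close> has integral 0, so the integral of
  \<open>g * g\<close> is that of \<open>(g - p) * g\<close> and at most \<open>e\<close> times the
  L1 norm of \<open>g\<close>. Hence \<open>g * g\<close> has integral 0.\<close>

lemma moments_zero_imp_zero:
  fixes g :: "real \<times> real \<Rightarrow> real"
  assumes cont: "continuous_on UNIV g" and bdd: "bounded {z. g z \<noteq> 0}"
    and moments: "\<And>i j. (LINT z|lborel. fst z ^ i * snd z ^ j * g z) = 0"
  shows "g z = 0"
proof -
  have int2: "integrable lborel (\<lambda>z. g z * g z)"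
    by (intro integrable_lborel_bounded_support bounded_support_mult bdd cont continuous_intros)
  have int1: "integrable lborel (\<lambda>z. \<bar>g z\<bar>)"
    using integrable_lborel_bounded_support[OF cont bdd] by simp
  define C where "C = (LINT z|lborel. \<bar>g z\<bar>)"
  have "(LINT z|lborel. g z * g z) \<le> e * C" if "e > 0" for e
  proof -
    let ?K = "closure {z. g z \<noteq> 0}"
    have "compact ?K"
      using bdd by simp
    then obtain p where p: "real_polynomial_function p" "\<And>z. z \<in> ?K \<Longrightarrow> \<bar>g z - p z\<bar> < e"
      by (rule Stone_Weierstrass_real_polynomial_function[OF _ continuous_on_subset[OF cont subset_UNIV] \<open>e > 0\<close>])
        blast
    have intp: "integrable lborel (\<lambda>z. p z * g z)"
      by (intro integrable_lborel_bounded_support bounded_support_mult bdd cont continuous_intros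
          continuous_on_real_polynomial_function p)
    have "(LINT z|lborel. p z * g z) = 0"
      using moments_zero_mult_polynomial[OF p(1) cont bdd moments, of 0 0] by simp
    then have "(LINT z|lborel. g z * g z) = (LINT z|lborel. g z * g z - p z * g z)"
      by (simp only: Bochner_Integration.integral_diff[OF int2 intp] diff_zero)
    also have "\<dots> \<le> (LINT z|lborel. e * \<bar>g z\<bar>)"
    proof (rule integral_mono)
      fix z
      show "g z * g z - p z * g z \<le> e * \<bar>g z\<bar>"
      proof (cases "g z = 0")
        case False
        then have "\<bar>g z - p z\<bar> < e"
          using closure_subset[of "{z. g z \<noteq> 0}"] by (intro p(2)) auto
        then have "\<bar>g z - p z\<bar> * \<bar>g z\<bar> \<le> e * \<bar>g z\<bar>"
          by (intro mult_right_mono) auto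
        then show ?thesis
          by (simp add: left_diff_distrib[symmetric] abs_mult[symmetric])
      qed simp
    qed (use int1 int2 intp in auto)
    finally show ?thesis
      by (simp add: C_def)
  qed
  then have le: "(LINT z|lborel. g z * g z) \<le> e" if "e > 0" for e
  proof -
    have "C \<ge> 0"
      by (simp add: C_def)
    \<comment> \<open>The divisor is \<open>C + 1\<close> because \<open>C\<close> itself may be
      0.\<close>
    then have "e / (C + 1) > 0" "e / (C + 1) * C \<le> e"
      using that by (auto simp: field_simps)
    then show ?thesis
      using \<open>\<And>e. e > 0 \<Longrightarrow> (LINT z|lborel. g z * g z) \<le> e * C\<close>[of "e / (C + 1)"] by linarith
  qed
  have "(LINT z|lborel. g z * g z) \<le> 0"
    by (rule field_le_epsilon) (use le in auto)
  then have "(LINT z|lborel. g z * g z) = 0"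
    by (intro antisym integral_nonneg_AE) auto
  then have "AE z in lborel. g z * g z = 0"
    using integral_nonneg_eq_0_iff_AE[OF int2] by simp
  then have "AE z in lborel. z \<notin> {z. g z \<noteq> 0}"
    by simp
  \<comment> \<open>By continuity this set is open, and an open null set is empty.\<close>
  then have "{z. g z \<noteq> 0} \<in> null_sets lborel"
    using AE_iff_null_sets[of "{z. g z \<noteq> 0}" lborel] open_Collect_neq[OF cont continuous_on_const[of _ 0]]
    by simp
  then have "negligible {z. g z \<noteq> 0}"
    using negligible_iff_null_sets null_sets_completionI by blast
  then have "{z. g z \<noteq> 0} = {}"
    using open_not_negligible open_Collect_neq[OF cont continuous_on_const[of _ 0]] by blast
  then show ?thesis
    by blast
qed

text \<open>Weighting the integrals over the lines \<open>x + t * y = v\<close> with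
  \<open>v ^ k\<close> and integrating over \<open>v\<close> gives the integral of
  \<open>(x + t * y) ^ k * g (x, y)\<close>. This is a polynomial in \<open>t\<close> whose
  coefficients are binomial multiples of the moments of total degree \<open>k\<close>; it vanishes
  on the infinite set \<open>T\<close>, so all these moments are 0.\<close>

lemma line_integrals_zero_imp_zero:
  fixes g :: "real \<times> real \<Rightarrow> real"
  assumes cont: "continuous_on UNIV g" and bdd: "bounded {z. g z \<noteq> 0}"
    and T: "infinite T"
    and lines: "\<And>t v. t \<in> T \<Longrightarrow> (LINT y|lborel. g (v - t * y, y)) = 0"
  shows "g z = 0"
proof (rule moments_zero_imp_zero[OF cont bdd])
  fix i j :: nat
  define k where "k = i + j"
  define M where "M l = (LINT z|lborel. fst z ^ (k - l) * snd z ^ l * g z)" for l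
  have int: "integrable lborel (\<lambda>z. fst z ^ a * snd z ^ b * g z)" for a b
    by (intro integrable_lborel_bounded_support bounded_support_mult bdd cont continuous_intros)
  define p where "p = (\<Sum>l\<le>k. monom (of_nat (k choose l) * M l) l)"
  have "poly p t = 0" if "t \<in> T" for t
  proof -
    let ?h = "\<lambda>(v, y). v ^ k * g (v - t * y, y)"
    let ?s = "\<lambda>z :: real \<times> real. (fst z + t * snd z, snd z)"
    \<comment> \<open>The shear \<open>?s\<close> maps the support of \<open>g\<close> onto that of
      the sheared function, which is therefore bounded; this yields the integrability that Fubini
      requires.\<close>
    have "bounded_linear ?s"
      by (intro bounded_linear_intros)
    then have "bounded (?s ` {z. g z \<noteq> 0})"
      by (intro bounded_linear_image bdd)
    moreover have "{z. g (fst z - t * snd z, snd z) \<noteq> 0} \<subseteq> ?s ` {z. g z \<noteq> 0}"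
      by (force simp: image_iff)
    ultimately have "bounded {z. g (fst z - t * snd z, snd z) \<noteq> 0}"
      using bounded_subset by blast
    then have inth: "integrable lborel ?h"
      unfolding case_prod_beta
      by (intro integrable_lborel_bounded_support bounded_support_mult continuous_intros
          continuous_on_compose2[OF cont]) auto
    have "0 = (LINT v|lborel. LINT y|lborel. v ^ k * g (v - t * y, y))"
      using lines[OF that] by simp
    also have "\<dots> = (LINT y|lborel. LINT v|lborel. v ^ k * g (v - t * y, y))"
      using lborel_pair.Fubini_integral[of "\<lambda>v y. v ^ k * g (v - t * y, y)"] inth
      by (simp add: lborel_prod)
    also have "\<dots> = (LINT y|lborel. LINT x|lborel. (x + t * y) ^ k * g (x, y))"
    proof (rule Bochner_Integration.integral_cong[OF refl])
      fix y
      show "(LINT v|lborel. v ^ k * g (v - t * y, y)) = (LINT x|lborel. (x + t * y) ^ k * g (x, y))"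
        using lborel_integral_real_affine[of 1 "\<lambda>v. v ^ k * g (v - t * y, y)" "t * y"]
        by (simp add: add.commute)
    qed
    also have "\<dots> = (LINT z|lborel. (fst z + t * snd z) ^ k * g z)"
    proof -
      have "integrable lborel (\<lambda>z. (fst z + t * snd z) ^ k * g z)"
        by (intro integrable_lborel_bounded_support bounded_support_mult bdd cont continuous_intros)
      then show ?thesis
        using lborel_pair.integral_snd[of "\<lambda>x y. (x + t * y) ^ k * g (x, y)"]
        by (simp add: lborel_prod case_prod_beta')
    qed
    also have "\<dots> = (LINT z|lborel. (\<Sum>l\<le>k. (of_nat (k choose l) * t ^ l) * (fst z ^ (k - l) * snd z ^ l * g z)))"
    proof (rule Bochner_Integration.integral_cong[OF refl])
      fix z :: "real \<times> real"
      show "(fst z + t * snd z) ^ k * g z =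
          (\<Sum>l\<le>k. (of_nat (k choose l) * t ^ l) * (fst z ^ (k - l) * snd z ^ l * g z))"
        unfolding add.commute[of "fst z"] binomial_ring sum_distrib_right
        by (intro sum.cong) (simp_all add: power_mult_distrib)
    qed
    also have "\<dots> = (\<Sum>l\<le>k. of_nat (k choose l) * t ^ l * M l)"
      unfolding M_def using int by (subst Bochner_Integration.integral_sum) auto
    also have "\<dots> = poly p t"
      by (simp add: p_def poly_sum poly_monom mult_ac)
    finally show ?thesis
      by simp
  qed
  then have "T \<subseteq> {t. poly p t = 0}"
    by blast
  then have "p = 0"
    using T poly_roots_finite finite_subset by blast
  \<comment> \<open>Since \<open>k = i + j\<close>, the coefficient at \<open>j\<close> is a nonzero
    multiple of the moment with exponents \<open>i\<close> and \<open>j\<close>.\<close>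
  moreover have "coeff p j = of_nat (k choose j) * M j"
    by (simp add: p_def coeff_sum k_def)
  ultimately have "M j = 0"
    by (simp add: k_def)
  then show "(LINT z|lborel. fst z ^ i * snd z ^ j * g z) = 0"
    by (simp add: M_def k_def)
qed

section \<open>Coordinates in space, zero extension of integrals, and bounds for the support\<close>

lemma norm_vector_3: "norm (vector [a, b, c] :: real ^ 3) = sqrt (a\<^sup>2 + b\<^sup>2 + c\<^sup>2)"
  by (simp add: norm_eq_sqrt_inner inner_vec_def sum_3 power2_eq_square)

lemma continuous_on_vector_3 [continuous_intros]:
  fixes f g h :: "'a :: topological_space \<Rightarrow> real"
  assumes "continuous_on A f" "continuous_on A g" "continuous_on A h"
  shows "continuous_on A (\<lambda>x. vector [f x, g x, h x] :: real ^ 3)"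
proof -
  have eq: "(\<lambda>x. vector [f x, g x, h x] :: real ^ 3) =
      (\<lambda>x. f x *\<^sub>R vector [1, 0, 0] + g x *\<^sub>R vector [0, 1, 0] + h x *\<^sub>R vector [0, 0, 1])"
    by (simp add: fun_eq_iff vec_eq_iff forall_3)
  show ?thesis
    unfolding eq by (intro continuous_intros assms)
qed

text \<open>The point is \<open>s\<close> times \<open>(cos \<beta>, sin \<beta>)\<close> plus
  \<open>q\<close> times the perpendicular unit vector
  \<open>(sin \<beta>, - cos \<beta>)\<close>.\<close>

lemma rotation_sum_squares:
  fixes s q :: real
  shows "(s * cos \<beta> + q * sin \<beta>)\<^sup>2 + (s * sin \<beta> - q * cos \<beta>)\<^sup>2 = s\<^sup>2 + q\<^sup>2"
proof -
  have "(s * cos \<beta> + q * sin \<beta>)\<^sup>2 + (s * sin \<beta> - q * cos \<beta>)\<^sup>2 =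
      (s\<^sup>2 + q\<^sup>2) * ((sin \<beta>)\<^sup>2 + (cos \<beta>)\<^sup>2)"
    by algebra
  then show ?thesis
    by simp
qed

text \<open>Extended by zero from \<open>A\<close> and from \<open>B\<close>, \<open>g\<close>
  becomes the same function on the whole line.\<close>

lemma integral_eq_integral_superset:
  fixes g :: "real \<Rightarrow> real"
  assumes "\<And>x. x \<in> B \<Longrightarrow> x \<notin> A \<Longrightarrow> g x = 0" "A \<subseteq> B"
  shows "integral B g = integral A g"
  using assms by (subst (1 2) integral_restrict_UNIV[symmetric]) (auto intro!: integral_cong)

text \<open>On a nonempty compact support the second coordinate attains a minimum, positive by
  assumption, and this serves as \<open>d\<close>; for empty support any positive number will
  do.\<close>

lemma compact_support_in_halfspaceE:
  fixes f :: "real ^ 3 \<Rightarrow> real"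
  assumes "compact_support_in f {x. x $ 2 > 0}"
  obtains R d where "0 < R" "0 < d" "\<And>x. f x \<noteq> 0 \<Longrightarrow> norm x \<le> R \<and> d \<le> x $ 2"
proof -
  let ?K = "closure {x. f x \<noteq> 0}"
  have K: "compact ?K" "?K \<subseteq> {x. x $ 2 > 0}"
    using assms by (auto simp: compact_support_in_def)
  obtain R where R: "0 < R" "\<And>x. x \<in> ?K \<Longrightarrow> norm x \<le> R"
    using compact_imp_bounded[OF K(1)] bounded_pos by metis
  obtain d where d: "0 < d" "\<And>x. x \<in> ?K \<Longrightarrow> d \<le> x $ 2"
  proof (cases "?K = {}")
    case False
    obtain y where "y \<in> ?K" "\<And>x. x \<in> ?K \<Longrightarrow> y $ 2 \<le> x $ 2"
      using continuous_attains_inf[OF K(1) False continuous_on_component[OF continuous_on_id], of 2] by auto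
    then show ?thesis
      using K(2) by (intro that[of "y $ 2"]) auto
  qed (use that[of 1] in auto)
  show ?thesis
    using R d closure_subset[of "{x. f x \<noteq> 0}"] by (intro that[of R d]) auto
qed

section \<open>Integrals along rays from a vertex\<close>

locale halfspace_supported =
  fixes f :: "real ^ 3 \<Rightarrow> real" and R d :: real
  assumes cont: "continuous_on UNIV f" and R: "0 < R" and d: "0 < d"
    and supp: "\<And>x. f x \<noteq> 0 \<Longrightarrow> norm x \<le> R \<and> d \<le> x $ 2"
begin

definition ray :: "real \<Rightarrow> real ^ 3 \<Rightarrow> real" where
  "ray u \<alpha> = integral {0..} (\<lambda>r. f (vector [u, 0, 0] + r *\<^sub>R \<alpha>) * r)"

lemma ray_support:
  assumes "1 \<le> norm \<alpha>" "f (vector [u, 0, 0] + r *\<^sub>R \<alpha>) \<noteq> 0"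
  shows "\<bar>r\<bar> \<le> R + \<bar>u\<bar>" "d \<le> r * \<alpha> $ 2"
proof -
  have "norm (r *\<^sub>R \<alpha>) \<le> norm (vector [u, 0, 0] + r *\<^sub>R \<alpha>) + norm (vector [u, 0, 0] :: real ^ 3)"
    using norm_triangle_ineq4[of "vector [u, 0, 0] + r *\<^sub>R \<alpha>" "vector [u, 0, 0] :: real ^ 3"] by simp
  also have "\<dots> \<le> R + \<bar>u\<bar>"
    using supp[OF assms(2)] by (simp add: norm_vector_3)
  finally have "\<bar>r\<bar> * norm \<alpha> \<le> R + \<bar>u\<bar>"
    by simp
  moreover have "\<bar>r\<bar> * 1 \<le> \<bar>r\<bar> * norm \<alpha>"
    using assms(1) by (intro mult_left_mono) auto
  ultimately show "\<bar>r\<bar> \<le> R + \<bar>u\<bar>"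
    by linarith
  show "d \<le> r * \<alpha> $ 2"
    using supp[OF assms(2)] by simp
qed

lemma ray_eq_integral_interval:
  assumes "1 \<le> norm \<alpha>"
  shows "ray u \<alpha> = integral {0..R + \<bar>u\<bar>} (\<lambda>r. f (vector [u, 0, 0] + r *\<^sub>R \<alpha>) * r)"
  unfolding ray_def
  by (rule integral_eq_integral_superset) (use ray_support(1)[OF assms] in force)+

text \<open>A negative \<open>r\<close> gives a point with nonpositive second coordinate, outside
  the support, so the half line can be replaced by the whole line, where affine substitution is
  available.\<close>

lemma ray_eq_lebesgue:
  assumes "1 \<le> norm \<alpha>" "0 \<le> \<alpha> $ 2"
  shows "ray u \<alpha> = (LINT r|lborel. f (vector [u, 0, 0] + r *\<^sub>R \<alpha>) * r)"
proof -
  let ?h = "\<lambda>r. f (vector [u, 0, 0] + r *\<^sub>R \<alpha>) * r"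
  have "bounded {r. ?h r \<noteq> 0}"
    by (rule bounded_subset[of "{-(R + \<bar>u\<bar>)..R + \<bar>u\<bar>}"]) (use ray_support(1)[OF assms(1), of u] in force)+
  then have "integrable lborel ?h"
    by (intro integrable_lborel_bounded_support continuous_intros continuous_on_compose2[OF cont]) auto
  then have "(LINT r|lborel. ?h r) = integral UNIV ?h"
    by (simp add: integral_lborel)
  also have "\<dots> = integral {0..} ?h"
  proof (rule integral_eq_integral_superset)
    fix r :: real
    assume "r \<notin> {0..}"
    then have "r * \<alpha> $ 2 < d"
      using assms(2) d mult_nonpos_nonneg[of r "\<alpha> $ 2"] by auto
    then show "?h r = 0"
      using ray_support(2)[OF assms(1), of u r] by auto
  qed auto
  finally show ?thesis
    by (simp add: ray_def)
qed

text \<open>Within the support \<open>r\<close> is at most \<open>R + \<bar>u\<bar>\<close>, so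
  along so low a direction \<open>r * \<alpha> $ 2\<close> never reaches \<open>d\<close>.\<close>

lemma ray_eq_0:
  assumes "1 \<le> norm \<alpha>" "\<alpha> $ 2 < d / (R + \<bar>u\<bar>)"
  shows "ray u \<alpha> = 0"
proof -
  have Ru: "0 < R + \<bar>u\<bar>"
    using R by linarith
  have "f (vector [u, 0, 0] + r *\<^sub>R \<alpha>) * r = 0" if "r \<in> {0..}" for r
  proof (rule ccontr)
    assume "f (vector [u, 0, 0] + r *\<^sub>R \<alpha>) * r \<noteq> 0"
    then have r: "0 < r" "r \<le> R + \<bar>u\<bar>" "d \<le> r * \<alpha> $ 2"
      using ray_support[OF assms(1), of u r] that by auto
    have "r * \<alpha> $ 2 < r * (d / (R + \<bar>u\<bar>))"
      using r(1) assms(2) by (rule mult_strict_left_mono[rotated])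
    also have "\<dots> \<le> (R + \<bar>u\<bar>) * (d / (R + \<bar>u\<bar>))"
      using r Ru d by (intro mult_right_mono) auto
    finally show False
      using r Ru by simp
  qed
  then show ?thesis
    using integral_eq_integral_superset[of "{0..}" "{}" "\<lambda>r. f (vector [u, 0, 0] + r *\<^sub>R \<alpha>) * r"]
    by (simp add: ray_def)
qed

section \<open>The upper hemisphere in the coordinates of the unit disc\<close>

text \<open>For \<open>z\<close> in the unit disc this is the second coordinate of the point of the
  upper unit hemisphere with first and third coordinates \<open>z\<close>.\<close>

definition height :: "real \<times> real \<Rightarrow> real" where
  "height z = sqrt (max 0 (1 - (fst z)\<^sup>2 - (snd z)\<^sup>2))"

text \<open>
  The cutoff at \<open>d / (R + \<bar>u\<bar>)\<close> changes nothing, because rays of smaller height miss the support of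
  \<open>f\<close> (see \<open>ray_eq_0\<close>); together with the truncation in \<open>height\<close> it makes \<open>disc u\<close> continuous on
  the whole plane.
\<close>

definition disc :: "real \<Rightarrow> real \<times> real \<Rightarrow> real" where
  "disc u z = ray u (vector [fst z, height z, snd z]) / max (height z) (d / (R + \<bar>u\<bar>))"

lemma norm_lift_ge_1: "1 \<le> norm (vector [fst z, height z, snd z] :: real ^ 3)"
  by (simp add: norm_vector_3 height_def)

lemma cutoff_pos: "0 < max (height z) (d / (R + \<bar>u\<bar>))"
  using d R by (simp add: less_max_iff_disj add_pos_nonneg)

lemma continuous_on_height: "continuous_on A height"
  unfolding height_def[abs_def] by (intro continuous_intros)

text \<open>For fixed \<open>u\<close> all the ray integrals run over one compact interval, so they
  depend continuously on the direction; the denominator is continuous and positive.\<close>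

lemma continuous_on_disc: "continuous_on UNIV (disc u)"
proof -
  have "continuous_on UNIV (\<lambda>z. integral (cbox 0 (R + \<bar>u\<bar>))
      (\<lambda>r. f (vector [u, 0, 0] + r *\<^sub>R vector [fst z, height z, snd z]) * r))"
    by (rule integral_continuous_on_param, unfold case_prod_beta)
      (intro continuous_intros continuous_on_compose2[OF cont] continuous_on_compose2[OF continuous_on_height];
        auto)
  then have "continuous_on UNIV (\<lambda>z. ray u (vector [fst z, height z, snd z]))"
    by (simp add: ray_eq_integral_interval norm_lift_ge_1)
  then show ?thesis
    unfolding disc_def[abs_def] using cutoff_pos[of _ u]
    by (intro continuous_intros continuous_on_height) (auto simp: less_le)
qed

text \<open>Outside the unit disc the height is 0, which is below the cutoff of
  \<open>ray_eq_0\<close>.\<close>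

lemma disc_support:
  assumes "disc u z \<noteq> 0"
  shows "(fst z)\<^sup>2 + (snd z)\<^sup>2 \<le> 1"
proof (rule ccontr)
  assume "\<not> (fst z)\<^sup>2 + (snd z)\<^sup>2 \<le> 1"
  then have "height z = 0"
    by (simp add: height_def max_def)
  then have "ray u (vector [fst z, height z, snd z]) = 0"
    using d R by (intro ray_eq_0 norm_lift_ge_1) (simp add: add_pos_nonneg)
  then show False
    using assms by (simp add: disc_def)
qed

lemma bounded_disc_support: "bounded {z. disc u z \<noteq> 0}"
proof (rule bounded_subset[of "cball 0 1"])
  show "{z. disc u z \<noteq> 0} \<subseteq> cball 0 1"
    using disc_support by (auto simp: norm_Pair)
qed auto

section \<open>Cone integrals as line integrals of \<open>disc\<close>\<close>

lemma conical_radon_eq_integral_ray: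
  "conical_radon f u \<beta> s = integral {0..2 * pi} (\<lambda>\<theta>. ray u
     (vector [s * cos \<beta> - sqrt (1 - s\<^sup>2) * cos \<theta> * sin \<beta>, sqrt (1 - s\<^sup>2) * sin \<theta>,
              s * sin \<beta> + sqrt (1 - s\<^sup>2) * cos \<theta> * cos \<beta>]))"
proof -
  have "s *\<^sub>R cone_axis \<beta> + sqrt (1 - s\<^sup>2) *\<^sub>R (cos \<theta> *\<^sub>R vector [- sin \<beta>, 0, cos \<beta>] + sin \<theta> *\<^sub>R vector [0, 1, 0]) =
     vector [s * cos \<beta> - sqrt (1 - s\<^sup>2) * cos \<theta> * sin \<beta>, sqrt (1 - s\<^sup>2) * sin \<theta>,
              s * sin \<beta> + sqrt (1 - s\<^sup>2) * cos \<theta> * cos \<beta>]" for \<theta>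
    by (simp add: vec_eq_iff forall_3 cone_axis_def mult.assoc)
  then show ?thesis
    by (simp add: conical_radon_def sphere_delta_integral_def ray_def)
qed

text \<open>The circle of directions on the cone projects onto the chord of the disc perpendicular
  to \<open>(cos \<beta>, sin \<beta>)\<close> at signed distance \<open>s\<close> from the centre.
  Under \<open>q = - \<rho> * cos \<theta>\<close> the derivative
  \<open>\<rho> * sin \<theta>\<close> is the height and cancels the denominator of
  \<open>disc\<close>. The other half of the circle has nonpositive second coordinate and
  contributes nothing.\<close>

lemma disc_line_integral:
  assumes "s \<in> {-1..1}"
  shows "(LINT q|lborel. disc u (s * cos \<beta> + q * sin \<beta>, s * sin \<beta> - q * cos \<beta>)) = conical_radon f u \<beta> s"
proof -
  define F where "F q = disc u (s * cos \<beta> + q * sin \<beta>, s * sin \<beta> - q * cos \<beta>)" for q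
  define \<rho> where "\<rho> = sqrt (1 - s\<^sup>2)"
  define A :: "real \<Rightarrow> real ^ 3" where
    "A \<theta> = vector [s * cos \<beta> - \<rho> * cos \<theta> * sin \<beta>, \<rho> * sin \<theta>, s * sin \<beta> + \<rho> * cos \<theta> * cos \<beta>]" for \<theta>
  have s2: "s\<^sup>2 \<le> 1"
    using assms by (simp add: abs_square_le_1 abs_le_iff)
  have \<rho>: "0 \<le> \<rho>" "\<rho>\<^sup>2 = 1 - s\<^sup>2"
    using s2 by (auto simp: \<rho>_def)
  note rot = rotation_sum_squares[of s \<beta>]
  have contF: "continuous_on UNIV F"
    unfolding F_def by (intro continuous_on_compose2[OF continuous_on_disc] continuous_intros) auto
  have suppF: "q \<in> {-\<rho>..\<rho>}" if "F q \<noteq> 0" for q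
  proof -
    have "q\<^sup>2 \<le> \<rho>\<^sup>2"
      using disc_support[OF that[unfolded F_def]] \<rho> rot[of q] by simp
    then show ?thesis
      using \<rho>(1) abs_le_square_iff[of q \<rho>] by auto
  qed
  have "bounded {q. F q \<noteq> 0}"
    by (rule bounded_subset[of "{-\<rho>..\<rho>}"]) (use suppF in auto)
  then have "(LINT q|lborel. F q) = integral UNIV F"
    using integral_lborel[OF integrable_lborel_bounded_support[OF contF]] by simp
  also have "\<dots> = integral {-\<rho>..\<rho>} F"
    by (rule integral_eq_integral_superset) (use suppF in auto)
  also have "\<dots> = integral {0..pi} (\<lambda>\<theta>. \<rho> * sin \<theta> * F (- \<rho> * cos \<theta>))"
  proof -
    have "((\<lambda>\<theta>. (\<rho> * sin \<theta>) *\<^sub>R F (- \<rho> * cos \<theta>)) has_integral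
        integral {- \<rho> * cos 0..- \<rho> * cos pi} F) {0..pi}"
    proof (rule has_integral_substitution[where c = "-\<rho>" and d = \<rho>])
      show "(\<lambda>\<theta>. - \<rho> * cos \<theta>) ` {0..pi} \<subseteq> {-\<rho>..\<rho>}"
      proof (rule image_subsetI)
        fix \<theta>
        show "- \<rho> * cos \<theta> \<in> {-\<rho>..\<rho>}"
          using \<rho>(1) mult_left_mono[of "cos \<theta>" 1 \<rho>] mult_left_mono[of "-1" "cos \<theta>" \<rho>] by auto
      qed
      show "((\<lambda>\<theta>. - \<rho> * cos \<theta>) has_field_derivative \<rho> * sin \<theta>) (at \<theta> within {0..pi})" for \<theta>
        by (auto intro!: derivative_eq_intros)
    qed (use \<rho>(1) contF in \<open>auto intro: continuous_on_subset\<close>)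
    then show ?thesis
      by (simp add: integral_unique)
  qed
  also have "\<dots> = integral {0..pi} (\<lambda>\<theta>. ray u (A \<theta>))"
  proof (rule Henstock_Kurzweil_Integration.integral_cong)
    fix \<theta>
    assume "\<theta> \<in> {0..pi}"
    then have w: "0 \<le> \<rho> * sin \<theta>"
      using \<rho>(1) by (simp add: sin_ge_zero)
    define z where "z = (s * cos \<beta> + (- \<rho> * cos \<theta>) * sin \<beta>, s * sin \<beta> - (- \<rho> * cos \<theta>) * cos \<beta>)"
    have "1 - (fst z)\<^sup>2 - (snd z)\<^sup>2 = (1 - s\<^sup>2) - \<rho>\<^sup>2 * (cos \<theta>)\<^sup>2"
      using rot[of "- \<rho> * cos \<theta>"] by (simp add: z_def power_mult_distrib)
    also have "\<dots> = (\<rho> * sin \<theta>)\<^sup>2"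
      by (simp add: \<rho>(2)[symmetric] sin_squared_eq power_mult_distrib algebra_simps)
    finally have height: "height z = \<rho> * sin \<theta>"
      using w by (simp add: height_def)
    then have A: "A \<theta> = vector [fst z, height z, snd z]"
      by (simp add: A_def z_def)
    have "ray u (A \<theta>) = height z * disc u z"
    \<comment> \<open>Below the cutoff both sides vanish; otherwise the maximum in
      \<open>disc\<close> is the height itself.\<close>
    proof (cases "height z < d / (R + \<bar>u\<bar>)")
      case True
      then show ?thesis
        using ray_eq_0[OF norm_lift_ge_1, of z u] by (simp add: disc_def A)
    next
      case False
      then show ?thesis
        using cutoff_pos[of z u] by (simp add: disc_def A max_def split: if_splits)
    qed
    then show "\<rho> * sin \<theta> * F (- \<rho> * cos \<theta>) = ray u (A \<theta>)"
      by (simp only: F_def height z_def[symmetric])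
  qed
  also have "\<dots> = integral {0..2 * pi} (\<lambda>\<theta>. ray u (A \<theta>))"
  proof (rule integral_eq_integral_superset[symmetric])
    fix \<theta> :: real
    assume "\<theta> \<in> {0..2 * pi}" "\<theta> \<notin> {0..pi}"
    then have "sin \<theta> \<le> 0"
      using sin_le_zero[of \<theta>] by (cases "\<theta> = 2 * pi") auto
    then have "\<rho> * sin \<theta> \<le> 0"
      using \<rho>(1) by (simp add: mult_nonneg_nonpos)
    moreover have "0 < d / (R + \<bar>u\<bar>)"
      using d R by (simp add: add_pos_nonneg)
    ultimately have "A \<theta> $ 2 < d / (R + \<bar>u\<bar>)"
      by (simp add: A_def)
    moreover have "norm (A \<theta>) = 1"
    proof -
      have "(s * cos \<beta> - \<rho> * cos \<theta> * sin \<beta>)\<^sup>2 + (s * sin \<beta> + \<rho> * cos \<theta> * cos \<beta>)\<^sup>2 = s\<^sup>2 + \<rho>\<^sup>2 * (cos \<theta>)\<^sup>2"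
        using rot[of "- \<rho> * cos \<theta>"] by (simp add: power_mult_distrib)
      then have "(s * cos \<beta> - \<rho> * cos \<theta> * sin \<beta>)\<^sup>2 + (\<rho> * sin \<theta>)\<^sup>2 + (s * sin \<beta> + \<rho> * cos \<theta> * cos \<beta>)\<^sup>2
          = s\<^sup>2 + \<rho>\<^sup>2"
        by (simp add: power_mult_distrib sin_squared_eq right_diff_distrib)
      then show ?thesis
        using \<rho>(2) by (simp add: A_def norm_vector_3)
    qed
    ultimately show "ray u (A \<theta>) = 0"
      by (intro ray_eq_0) auto
  qed auto
  also have "\<dots> = conical_radon f u \<beta> s"
    by (simp add: conical_radon_eq_integral_ray A_def \<rho>_def)
  finally show ?thesis
    by (simp add: F_def)
qed

section \<open>From vanishing cone integrals to vanishing ray integrals and to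
  \<open>f = 0\<close>\<close>

text \<open>For \<open>t = tan \<beta>\<close> the line \<open>x = v - t * y\<close> is
  \<open>x * cos \<beta> + y * sin \<beta> = s\<close> with \<open>s = v * cos \<beta>\<close>. If
  \<open>\<bar>s\<bar> \<le> 1\<close>, the integral over it is a cone integral up to a factor;
  otherwise the line misses the unit disc.\<close>

lemma disc_eq_0:
  assumes inf: "infinite (tan ` B)" and B: "\<And>\<beta>. \<beta> \<in> B \<Longrightarrow> cos \<beta> \<noteq> 0"
    and radon: "\<And>\<beta> s. \<beta> \<in> B \<Longrightarrow> s \<in> {-1..1} \<Longrightarrow> conical_radon f u \<beta> s = 0"
  shows "disc u z = 0"
proof (rule line_integrals_zero_imp_zero[OF continuous_on_disc bounded_disc_support inf])
  fix t v
  assume "t \<in> tan ` B"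
  then obtain \<beta> where \<beta>: "\<beta> \<in> B" "t = tan \<beta>"
    by auto
  define s where "s = v * cos \<beta>"
  have c: "cos \<beta> \<noteq> 0"
    using B \<beta> by auto
  \<comment> \<open>The substitution \<open>y = s * sin \<beta> - q * cos \<beta>\<close> passes to
    the arc length parameter \<open>q\<close> of \<open>disc_line_integral\<close>.\<close>
  have "(LINT y|lborel. disc u (v - t * y, y)) =
      \<bar>- cos \<beta>\<bar> * (LINT q|lborel. disc u (v - t * (s * sin \<beta> + - cos \<beta> * q), s * sin \<beta> + - cos \<beta> * q))"
    using lborel_integral_real_affine[of "- cos \<beta>" "\<lambda>y. disc u (v - t * y, y)" "s * sin \<beta>"] c by simp
  also have "(\<lambda>q. disc u (v - t * (s * sin \<beta> + - cos \<beta> * q), s * sin \<beta> + - cos \<beta> * q)) =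
      (\<lambda>q. disc u (s * cos \<beta> + q * sin \<beta>, s * sin \<beta> - q * cos \<beta>))"
  proof
    fix q
    have "t * (s * sin \<beta> + - cos \<beta> * q) = (t * cos \<beta>) * (v * sin \<beta> - q)"
      by (simp add: s_def algebra_simps)
    also have "t * cos \<beta> = sin \<beta>"
      using c by (simp add: \<beta> tan_def)
    finally have "v - t * (s * sin \<beta> + - cos \<beta> * q) = s * cos \<beta> + q * sin \<beta>"
      by (simp add: s_def cos_squared_eq power2_eq_square[symmetric] algebra_simps)
    then show "disc u (v - t * (s * sin \<beta> + - cos \<beta> * q), s * sin \<beta> + - cos \<beta> * q) =
        disc u (s * cos \<beta> + q * sin \<beta>, s * sin \<beta> - q * cos \<beta>)"
      by (simp add: mult.commute)
  qed
  also have "(LINT q|lborel. disc u (s * cos \<beta> + q * sin \<beta>, s * sin \<beta> - q * cos \<beta>)) = 0"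
  proof (cases "s \<in> {-1..1}")
    case True
    then show ?thesis
      using disc_line_integral radon \<beta>(1) by simp
  next
    case False
    have "disc u (s * cos \<beta> + q * sin \<beta>, s * sin \<beta> - q * cos \<beta>) = 0" for q
    proof (rule ccontr)
      assume "disc u (s * cos \<beta> + q * sin \<beta>, s * sin \<beta> - q * cos \<beta>) \<noteq> 0"
      then have "(s * cos \<beta> + q * sin \<beta>)\<^sup>2 + (s * sin \<beta> - q * cos \<beta>)\<^sup>2 \<le> 1"
        using disc_support by fastforce
      then have "s\<^sup>2 + q\<^sup>2 \<le> 1"
        by (simp only: rotation_sum_squares)
      then have "s\<^sup>2 \<le> 1"
        using zero_le_power2[of q] by linarith
      then show False
        using False by (simp add: abs_square_le_1 abs_le_iff)
    qed
    then show ?thesis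
      by simp
  qed
  finally show "(LINT y|lborel. disc u (v - t * y, y)) = 0"
    by simp
qed

text \<open>The plane \<open>x3 = m * x2\<close> through \<open>x\<close> contains all vertices. In
  its coordinates \<open>(x1, x2)\<close>, the ray from \<open>(v, 0, 0)\<close> in direction
  \<open>(- t, 1, m)\<close> runs along the line \<open>(v - t * y, y)\<close>. The weight
  \<open>r\<close> is proportional to \<open>y\<close>, whence the factor \<open>snd z\<close> in
  \<open>g\<close>. Every real slope \<open>t\<close> occurs.\<close>

lemma eq_0_if_disc_eq_0:
  assumes disc: "\<And>u z. disc u z = 0"
  shows "f x = 0"
proof (cases "0 < x $ 2")
  case False
  then show ?thesis
    using supp[of x] d by force
next
  case True
  define m where "m = x $ 3 / x $ 2"
  define g where "g z = snd z * f (vector [fst z, snd z, m * snd z])" for z :: "real \<times> real"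
  have "g z = 0" for z
  proof (rule line_integrals_zero_imp_zero[of g UNIV])
    show "continuous_on UNIV g"
      unfolding g_def by (intro continuous_intros continuous_on_compose2[OF cont]) auto
    show "bounded {z. g z \<noteq> 0}"
    proof (rule bounded_subset[of "cball 0 R"])
      show "{z. g z \<noteq> 0} \<subseteq> cball 0 R"
      proof safe
        fix a b
        assume "g (a, b) \<noteq> 0"
        then have "sqrt (a\<^sup>2 + b\<^sup>2 + (m * b)\<^sup>2) \<le> R"
          using supp[of "vector [a, b, m * b]"] by (simp add: g_def norm_vector_3)
        moreover have "norm (a, b) \<le> sqrt (a\<^sup>2 + b\<^sup>2 + (m * b)\<^sup>2)"
          by (simp add: norm_Pair)
        ultimately have "norm (a, b) \<le> R"
          by linarith
        then show "(a, b) \<in> cball 0 R"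
          by simp
      qed
    qed auto
    show "infinite (UNIV :: real set)"
      by (rule infinite_UNIV_char_0)
    fix t v :: real
    \<comment> \<open>\<open>N\<close> is the length of \<open>(- t, 1, m)\<close>; the normalised
      direction lies on the upper hemisphere over \<open>z\<close>, at height \<open>1 / N\<close>,
      and \<open>r = N * y\<close> below.\<close>
    define N where "N = sqrt (1 + t\<^sup>2 + m\<^sup>2)"
    have N2: "N\<^sup>2 = 1 + t\<^sup>2 + m\<^sup>2" and N: "0 < N"
      by (auto simp: N_def add_pos_nonneg)
    define z where "z = (- t / N, m / N)"
    have "1 - (fst z)\<^sup>2 - (snd z)\<^sup>2 = (N\<^sup>2 - t\<^sup>2 - m\<^sup>2) / N\<^sup>2"
      using N by (simp add: z_def power_divide diff_divide_distrib)
    also have "\<dots> = (1 / N)\<^sup>2"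
      by (simp add: N2 power_divide)
    finally have height: "height z = 1 / N"
      using N by (simp add: height_def)
    have "0 = ray v (vector [fst z, height z, snd z])"
      using disc[of v z] cutoff_pos[of z v] by (simp add: disc_def)
    also have "\<dots> = (LINT r|lborel. f (vector [v, 0, 0] + r *\<^sub>R vector [fst z, height z, snd z]) * r)"
      using N by (intro ray_eq_lebesgue norm_lift_ge_1) (simp add: height)
    also have "\<dots> = N * (LINT y|lborel. f (vector [v, 0, 0] + (N * y) *\<^sub>R vector [fst z, height z, snd z]) * (N * y))"
      using lborel_integral_real_affine[of N "\<lambda>r. f (vector [v, 0, 0] + r *\<^sub>R vector [fst z, height z, snd z]) * r" 0] N
      by simp
    also have "(\<lambda>y. f (vector [v, 0, 0] + (N * y) *\<^sub>R vector [fst z, height z, snd z]) * (N * y)) =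
        (\<lambda>y. N * g (v - t * y, y))"
    proof
      fix y
      have "vector [v, 0, 0] + (N * y) *\<^sub>R vector [fst z, height z, snd z] = (vector [v - t * y, y, m * y] :: real ^ 3)"
        using N by (simp add: vec_eq_iff forall_3 height) (simp add: z_def)
      then show "f (vector [v, 0, 0] + (N * y) *\<^sub>R vector [fst z, height z, snd z]) * (N * y) = N * g (v - t * y, y)"
        by (simp add: g_def)
    qed
    finally show "(LINT y|lborel. g (v - t * y, y)) = 0"
      using N by simp
  qed
  then have "g (x $ 1, x $ 2) = 0" .
  moreover have "vector [x $ 1, x $ 2, m * x $ 2] = x"
    using True by (simp add: vec_eq_iff forall_3 m_def)
  ultimately show ?thesis
    using True by (simp add: g_def)
qed

end

section \<open>Uniqueness from the cone axes with directions in \<open>S\<close>\<close>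

theorem theorem3:
  fixes S :: "(real ^ 2) set" and f :: "real ^ 3 \<Rightarrow> real"
  assumes "S \<subseteq> sphere 0 1"
    and "\<not> (\<exists>d p. homogeneous_poly2 d p \<and> p \<noteq> 0 \<and> (\<forall>v\<in>S. eval_poly2 p v = 0))"
    and "continuous_on UNIV f"
    and "compact_support_in f {x. x $ 2 > 0}"
    and "\<And>\<beta> u s. \<beta> \<in> {0..<2 * pi} \<Longrightarrow> vector [cos \<beta>, sin \<beta>] \<in> S \<Longrightarrow> s \<in> {-1..1}
           \<Longrightarrow> conical_radon f u \<beta> s = 0"
  shows "f = (\<lambda>x. 0)"
proof
  fix x
  obtain R d where "0 < R" "0 < d" "\<And>x. f x \<noteq> 0 \<Longrightarrow> norm x \<le> R \<and> d \<le> x $ 2"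
    using compact_support_in_halfspaceE[OF assms(4)] by metis
  then interpret halfspace_supported f R d
    using assms(3) by unfold_locales auto
  \<comment> \<open>Angles with \<open>cos \<beta> = 0\<close> have no slope and are left out; by
    \<open>infinite_slopes\<close> the others still give infinitely many values of
    \<open>tan \<beta>\<close>.\<close>
  define B where "B = {\<beta> \<in> {0..<2 * pi}. vector [cos \<beta>, sin \<beta>] \<in> S \<and> cos \<beta> \<noteq> 0}"
  have "(\<lambda>v. v $ 2 / v $ 1) ` {v \<in> S. v $ 1 \<noteq> 0} \<subseteq> tan ` B"
  proof safe
    fix v
    assume v: "v \<in> S" "v $ 1 \<noteq> 0"
    then have "norm v = 1"
      using assms(1) by auto
    then have "(v $ 1)\<^sup>2 + (v $ 2)\<^sup>2 = 1"
      by (simp add: norm_eq_1 inner_vec_def sum_2 power2_eq_square)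
    then obtain \<beta> where \<beta>: "0 \<le> \<beta>" "\<beta> < 2 * pi" "v $ 1 = cos \<beta>" "v $ 2 = sin \<beta>"
      using sincos_total_2pi by metis
    then have "vector [cos \<beta>, sin \<beta>] = v"
      by (simp add: vec_eq_iff forall_2)
    then show "v $ 2 / v $ 1 \<in> tan ` B"
      using \<beta> v by (auto simp: B_def tan_def intro!: image_eqI[of _ _ \<beta>])
  qed
  then have "infinite (tan ` B)"
    using infinite_slopes[OF assms(2)] finite_subset by blast
  then have "disc u z = 0" for u z
    by (rule disc_eq_0) (use assms(5) in \<open>auto simp: B_def\<close>)
  then show "f x = 0"
    by (rule eq_0_if_disc_eq_0)
qed

end
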